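(* Let $V$ be a vector space over a field. The semigroup $L(V)$ is unit-regular if and only if $V$ is finite-dimensional.
   Context: $L(V)$ is the semigroup of all linear maps $V\to V$ under composition. A semigroup $S$ with identity is unit-regular if for every $s\in S$ there is a unit $u$ of $S$ with $sus=s$. *)

theory Defs
  imports Complex_Main "HOL-Algebra.Group"
begin

locale unit_regular_monoid = monoid S for S (structure) +
  assumes unit_regular:
    "s \<in> carrier S \<Longrightarrow> \<exists>u \<in> Units S. s \<otimes> u \<otimes> s = s"

text \<open>
  The vector space $V$ is the whole type \<open>'v\<close>, with scalar multiplication \<open>scale\<close>
  satisfying the library's locale \<^locale>\<open>vector_space\<close>.
\<close>

definition linear_monoid :: "('k::field \<Rightarrow> 'v::ab_group_add \<Rightarrow> 'v) \<Rightarrow> ('v \<Rightarrow> 'v) monoid" where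
  "linear_monoid scale =
     \<lparr>carrier = {f. Vector_Spaces.linear scale scale f}, mult = (\<circ>), one = id\<rparr>"

lemma monoid_linear_monoid:
  assumes "vector_space scale"
  shows "monoid (linear_monoid scale)"
proof -
  interpret vector_space scale by (fact assms)
  show ?thesis
    unfolding linear_monoid_def
    by (rule monoidI) (auto intro: Vector_Spaces.linear_compose linear_id simp: comp_assoc)
qed

text \<open>
  The locale \<^locale>\<open>finite_dimensional_vector_space\<close> carries a chosen finite basis as a
  parameter; finite-dimensionality of the space is the existence of such a basis.
\<close>

definition finite_dimensional :: "('k::field \<Rightarrow> 'v::ab_group_add \<Rightarrow> 'v) \<Rightarrow> bool" where
  "finite_dimensional scale \<longleftrightarrow> (\<exists>B. finite_dimensional_vector_space scale B)"

end

theory Submission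
  imports Defs
begin

text \<open>
  If \<open>V\<close> is finite-dimensional, a linear map \<open>f\<close> has a linear section \<open>g\<close> over its range, and \<open>g\<close>,
  restricted to a basis of the range, extends to an injective, hence invertible, linear map \<open>u\<close>;
  then \<open>f \<circ> u\<close> is the identity on the range of \<open>f\<close>, so \<open>f \<circ> u \<circ> f = f\<close>. Conversely,
  \<open>f \<circ> u \<circ> f = f\<close> with \<open>f\<close> injective and \<open>u\<close> invertible forces \<open>f = u\<inverse>\<close>, so \<open>f\<close> is surjective;
  but an infinite basis is equipotent with a proper subset of itself, which yields an injective
  linear map that is not surjective.
\<close>

context vector_space
begin

text \<open>An injective linear map has a linear left inverse, and a left inverse of a bijection is
  its inverse. So bijectivity alone makes a linear map a unit.\<close>

lemma linear_inv_into:
  assumes "Vector_Spaces.linear scale scale f" "bij f"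
  shows "Vector_Spaces.linear scale scale (inv_into UNIV f)"
proof -
  interpret vector_space_pair scale scale ..
  obtain g where g: "Vector_Spaces.linear scale scale g" "g \<circ> f = id"
    using linear_injective_left_inverse[OF assms(1) bij_is_inj[OF assms(2)]] by blast
  have "inv_into UNIV f = g"
    using g(2) assms(2) by (metis bij_is_surj left_right_inverse_eq surj_iff)
  with g(1) show ?thesis by simp
qed

lemma Units_linear_monoid:
  "Units (linear_monoid scale) = {f. Vector_Spaces.linear scale scale f \<and> bij f}"
proof (intro equalityI subsetI)
  fix f assume "f \<in> Units (linear_monoid scale)"
  then show "f \<in> {f. Vector_Spaces.linear scale scale f \<and> bij f}"
    by (auto simp: Units_def linear_monoid_def intro: o_bij)
next
  fix f assume "f \<in> {f. Vector_Spaces.linear scale scale f \<and> bij f}"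
  then have f: "Vector_Spaces.linear scale scale f" "bij f" by simp_all
  then have "inv_into UNIV f \<circ> f = id" "f \<circ> inv_into UNIV f = id"
    by (simp_all add: bij_is_inj bij_is_surj flip: surj_iff)
  with f linear_inv_into[OF f] show "f \<in> Units (linear_monoid scale)"
    unfolding Units_def linear_monoid_def by auto
qed

text \<open>Unfolds the monoid record once, so that both directions of the theorem can argue about
  linear maps alone.\<close>

lemma unit_regular_linear_monoid_iff:
  "unit_regular_monoid (linear_monoid scale) \<longleftrightarrow>
    (\<forall>f. Vector_Spaces.linear scale scale f \<longrightarrow>
      (\<exists>u. Vector_Spaces.linear scale scale u \<and> bij u \<and> f \<circ> u \<circ> f = f))"
  using monoid_linear_monoid[OF vector_space_axioms]
  unfolding unit_regular_monoid_def unit_regular_monoid_axioms_def Units_linear_monoid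
  by (simp add: linear_monoid_def Bex_def)

lemma exists_linear_inj_not_surj:
  assumes "independent B" "span B = UNIV" "infinite B"
  shows "\<exists>f. Vector_Spaces.linear scale scale f \<and> inj f \<and> \<not> surj f"
proof -
  interpret vector_space_pair scale scale ..
  obtain b where b: "b \<in> B"
    using \<open>infinite B\<close> by (metis ex_in_conv finite.emptyI)
  obtain h where h: "bij_betw h B (B - {b})"
    using infinite_imp_bij_betw[OF \<open>infinite B\<close>] by blast
  obtain f where f: "Vector_Spaces.linear scale scale f" "\<And>x. x \<in> B \<Longrightarrow> f x = h x"
    using linear_independent_extend[OF assms(1)] by blast
  have fB: "f ` B = B - {b}" "inj_on f B"
    using h f(2) by (auto simp: bij_betw_def inj_on_def image_def)
  have "independent (f ` B)"
    unfolding fB(1) using assms(1) by (rule independent_mono) blast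
  \<comment> \<open>\<open>f\<close> is injective on \<open>B\<close> with independent image, hence
    injective on \<open>span B\<close>, the whole space.\<close>
  then have "inj f"
    using linear_inj_on_span_independent_image[OF f(1)] fB(2) assms(2) by metis
  moreover have "range f = span (B - {b})"
    using linear_span_image[OF f(1), of B] fB(1) assms(2) by simp
  \<comment> \<open>Independence of \<open>B\<close> keeps \<open>b\<close> out of
    \<open>span (B - {b})\<close>.\<close>
  then have "\<not> surj f"
    using assms(1) b unfolding dependent_def by blast
  ultimately show ?thesis using f(1) by blast
qed

end

lemma (in finite_dimensional_vector_space) exists_linear_bij_pseudoinverse:
  assumes f: "Vector_Spaces.linear scale scale f"
  shows "\<exists>u. Vector_Spaces.linear scale scale u \<and> bij u \<and> f \<circ> u \<circ> f = f"
proof -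
  interpret vector_space_pair scale scale ..
  obtain g where g: "Vector_Spaces.linear scale scale g" "\<And>v. v \<in> range f \<Longrightarrow> f (g v) = v"
    using linear_exists_right_inverse_on[OF f subspace_UNIV] by blast
  obtain C where C: "independent C" "span C = range f"
    using basis_subspace_exists[OF linear_subspace_image[OF f subspace_UNIV]] by metis
  have inj: "inj_on g (span C)"
    unfolding C(2) by (rule inj_on_inverseI[of _ f]) (rule g(2))
  have "independent (g ` C)"
    using linear_independent_injective_image[OF g(1) C(1) inj] .
  moreover have "inj_on g C"
    using inj span_superset by (rule inj_on_subset)
  \<comment> \<open>Here finite dimension matters: \<open>C\<close> and its image under
    \<open>g\<close> are equally large finite independent sets, so completing each to a basis adds
    equally many vectors, which can be matched.\<close>
  ultimately obtain u where u: "Vector_Spaces.linear scale scale u" "inj u"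
      "\<And>x. x \<in> C \<Longrightarrow> u x = g x"
    using linear_independent_extend_inj[OF C(1)] by blast
  have "f (u (f x)) = f x" for x
  proof -
    \<comment> \<open>Agreement of \<open>u\<close> and \<open>g\<close> on \<open>C\<close> spreads
      to \<open>span C\<close>, which is \<open>range f\<close>.\<close>
    have "f x \<in> span C" using C(2) by simp
    from linear_eq_on[OF u(1) g(1) this u(3)] have "u (f x) = g (f x)" .
    then show ?thesis using g(2) by simp
  qed
  moreover have "bij u"
    using u(2) linear_inj_imp_surj[OF u(1,2)] by (rule bijI)
  ultimately show ?thesis using u(1) by (auto simp: fun_eq_iff)
qed

theorem theorem4p9:
  fixes scale :: "'k::field \<Rightarrow> 'v::ab_group_add \<Rightarrow> 'v"
  assumes "vector_space scale"
  shows "unit_regular_monoid (linear_monoid scale) \<longleftrightarrow> finite_dimensional scale"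
proof -
  interpret vector_space scale by (fact assms)
  show ?thesis
  proof
    assume *: "unit_regular_monoid (linear_monoid scale)"
    have surj: "surj f" if f: "Vector_Spaces.linear scale scale f" "inj f" for f
    proof -
      obtain u where u: "bij u" "f \<circ> u \<circ> f = f"
        using * f(1) unfolding unit_regular_linear_monoid_iff by blast
      \<comment> \<open>Injectivity cancels the outer \<open>f\<close> in
        \<open>f (u (f x)) = f x\<close>.\<close>
      have "u (f x) = x" for x
        using u(2) f(2) by (metis comp_apply injD)
      then have "f = inv_into UNIV u"
        using u(1) by (metis bij_inv_eq_iff ext)
      then show ?thesis using u(1) by (simp add: bij_imp_bij_inv bij_is_surj)
    qed
    obtain B where B: "independent B" "span B = UNIV"
      using maximal_independent_subset[of UNIV] by (metis top.extremum_uniqueI)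
    with surj have "finite B"
      using exists_linear_inj_not_surj[OF B] by blast
    with B have "finite_dimensional_vector_space scale B"
      by unfold_locales
    then show "finite_dimensional scale"
      unfolding finite_dimensional_def by blast
  next
    assume "finite_dimensional scale"
    then obtain B where "finite_dimensional_vector_space scale B"
      unfolding finite_dimensional_def by blast
    then interpret finite_dimensional_vector_space scale B .
    show "unit_regular_monoid (linear_monoid scale)"
      unfolding unit_regular_linear_monoid_iff using exists_linear_bij_pseudoinverse by blast
  qed
qed

end
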